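(* For integers $n\geq 0$ let $P_n(x)=2^{-2n}\sum_{j=0}^{n} 2^j\binom{2n-2j}{n-j}\binom{n+j}{j}(x+1)^j$, write $P_n(x)=\sum_{i=0}^n d_i(n)x^i$, and define $R_n(x)=\sum_{i=0}^n \frac{d_i(n)}{(i+2)!}x^i$. Then $\{R_n(x)\}_{n\geq 0}$ is a Sturm sequence. In particular, $R_n(x)$ has only real zeros for every $n\geq 1$.
   Context: A real polynomial is standard if it is zero or has positive leading coefficient. $\mathrm{RZ}$ denotes the set of real polynomials with only real zeros. If $f\in\mathrm{RZ}$ has degree $n$ with zeros $r_n\le\cdots\le r_1$ and $g\in\mathrm{RZ}$ has degree $m$ with zeros $s_m\le\cdots\le s_1$, then $g$ interlaces $f$ if $n=m+1$ and $r_n\le s_{n-1}\le r_{n-1}\le\cdots\le r_2\le s_1\le r_1$; $g$ strictly interlaces $f$ (written $g\prec f$) if in addition $f$ and $g$ have no common zeros. By convention, for any real numbers $a,b,c$, the constant $a$ is in $\mathrm{RZ}$ and $a\prec bx+c$. A sequence $\{f_n(x)\}_{n\ge 0}$ of standard polynomials is a Sturm sequence if for all $n\ge 0$: $\deg f_n=n$, $f_n\in\mathrm{RZ}$, and $f_n\prec f_{n+1}$. *)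

theory Defs
  imports Complex_Main "HOL-Computational_Algebra.Computational_Algebra"
begin

definition standard_poly :: "real poly \<Rightarrow> bool" where
  "standard_poly f \<longleftrightarrow> f = 0 \<or> lead_coeff f > 0"

text \<open>
  The zeros meant here are the complex ones. The first disjunct is the convention that every
  constant, including the zero polynomial, belongs to the set.
\<close>
definition RZ :: "real poly set" where
  "RZ = {f. degree f = 0 \<or>
            (\<forall>z::complex. poly (map_poly complex_of_real f) z = 0 \<longrightarrow> z \<in> \<real>)}"

text \<open>
  Real zeros with multiplicity, in decreasing order: \<open>zeros_desc f ! (i - 1)\<close> is the
  \<open>i\<close>-th largest zero \<open>r\<^sub>i\<close>. For nonzero \<open>f \<in> RZ\<close> the list has length \<open>degree f\<close>.
\<close>
definition zeros_desc :: "real poly \<Rightarrow> real list" where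
  "zeros_desc f = rev (sorted_list_of_multiset (proots f))"

text \<open>
  With \<open>r\<close> the zeros of \<open>f\<close> and \<open>s\<close> those of \<open>g\<close>, the chain of inequalities is
  \<open>r\<^sub>i\<^sub>+\<^sub>1 \<le> s\<^sub>i \<le> r\<^sub>i\<close> for \<open>1 \<le> i \<le> deg g\<close>; list indices are shifted by one.
\<close>
definition interlaces :: "real poly \<Rightarrow> real poly \<Rightarrow> bool" where
  "interlaces g f \<longleftrightarrow> f \<in> RZ \<and> g \<in> RZ \<and> degree f = degree g + 1 \<and>
     (\<forall>i<degree g. zeros_desc f ! Suc i \<le> zeros_desc g ! i \<and>
                    zeros_desc g ! i \<le> zeros_desc f ! i)"

text \<open>
  The second disjunct is the convention \<open>a \<prec> b x + c\<close> for arbitrary reals \<open>a, b, c\<close>.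
\<close>
definition strictly_interlaces :: "real poly \<Rightarrow> real poly \<Rightarrow> bool" (infix "\<prec>" 50) where
  "g \<prec> f \<longleftrightarrow>
     (interlaces g f \<and> (\<nexists>x. poly f x = 0 \<and> poly g x = 0)) \<or>
     (\<exists>a b c. g = [:a:] \<and> f = [:c, b:])"

definition Sturm_sequence :: "(nat \<Rightarrow> real poly) \<Rightarrow> bool" where
  "Sturm_sequence f \<longleftrightarrow>
     (\<forall>n. standard_poly (f n) \<and> degree (f n) = n \<and> f n \<in> RZ \<and> f n \<prec> f (Suc n))"

definition P_poly :: "nat \<Rightarrow> real poly" where
  "P_poly n = smult (1 / 2 ^ (2 * n))
     (\<Sum>j=0..n. smult (2 ^ j * real ((2 * n - 2 * j) choose (n - j)) * real ((n + j) choose j))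
                    ([:1, 1:] ^ j))"

definition d_coeff :: "nat \<Rightarrow> nat \<Rightarrow> real" where
  "d_coeff i n = coeff (P_poly n) i"

definition R_poly :: "nat \<Rightarrow> real poly" where
  "R_poly n = (\<Sum>i=0..n. monom (d_coeff i n / fact (i + 2)) i)"

end

theory Submission
  imports Defs
begin

text \<open>
  In powers of \<open>x + 1\<close> the coefficients of \<open>P\<^sub>n\<close> are hypergeometric terms, which yields two first-order
  contiguous relations: one expresses \<open>P\<^sub>n\<^sub>+\<^sub>1\<close> and the other \<open>P\<^sub>n\<^sub>-\<^sub>1\<close> through \<open>P\<^sub>n\<close> and its derivative.
  In a suitable combination of their coefficientwise forms the weights \<open>1 / (i + 2)!\<close> can be absorbed, giving
  \[4n(n+1)(n+3) R_{n+1} = 2n(8n^2+8n+7 + (4n+2)x) R_n + 20 n x R_n' - (16n^2-1)(n-2) R_{n-1}.\]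
  All zeros of \<open>R\<^sub>n\<close> are negative, and at such a zero \<open>R\<^sub>n'\<close> and \<open>R\<^sub>n\<^sub>-\<^sub>1\<close> have the same sign by
  interlacing. Hence for \<open>n \<ge> 2\<close> the polynomial \<open>R\<^sub>n\<^sub>+\<^sub>1\<close> has the sign opposite to \<open>R\<^sub>n'\<close> at every zero of
  \<open>R\<^sub>n\<close>, and the intermediate value theorem produces \<open>n + 1\<close> zeros separated by those of \<open>R\<^sub>n\<close>.
  The sign condition fails at \<open>n = 1\<close>, so the induction starts from \<open>R\<^sub>2 = (x + 3)(x + 7) / 16\<close>.
\<close>

section \<open>Interlacing and sign changes\<close>

text \<open>The zeros are given by an indexed family so that their positions can be compared. The
  family need not be ordered here; where order matters below it is increasing, the reverse of
  \<open>zeros_desc\<close>.\<close>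

definition split_over :: "nat \<Rightarrow> (nat \<Rightarrow> real) \<Rightarrow> real poly \<Rightarrow> bool" where
  "split_over n r f \<longleftrightarrow> (\<exists>c>0. f = smult c (\<Prod>i<n. [:- r i, 1:]))"

text \<open>The strict chain \<open>s 0 < r 0 < s 1 < ... < s n\<close> makes all zeros simple and
  excludes common ones, so both parts of strict interlacing follow from it.\<close>

definition interleaved :: "nat \<Rightarrow> real poly \<Rightarrow> real poly \<Rightarrow> bool" where
  "interleaved n g f \<longleftrightarrow> (\<exists>r s. split_over n r g \<and> split_over (Suc n) s f \<and>
     (\<forall>i<n. s i < r i \<and> r i < s (Suc i)))"

lemma alternating_less:
  fixes r s :: "nat \<Rightarrow> real"
  assumes rs: "\<And>i. i < n \<Longrightarrow> s i < r i \<and> r i < s (Suc i)"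
  shows "i < j \<Longrightarrow> j \<le> n \<Longrightarrow> s i < s j"
    and "i \<le> j \<Longrightarrow> j < n \<Longrightarrow> s i < r j"
    and "j < i \<Longrightarrow> i \<le> n \<Longrightarrow> r j < s i"
proof -
  have s_less: "s i < s j" if "i < j" "j \<le> n" for i j
    using that
  proof (induction j)
    case (Suc j)
    then show ?case using rs[of j] by (cases "i = j") auto
  qed simp
  have s_r: "s i < r j" if "i \<le> j" "j < n" for i j
    using rs[of j] s_less[of i j] that by (cases "i = j") auto
  have r_s: "r j < s i" if "j < i" "i \<le> n" for i j
    using rs[of j] s_less[of "Suc j" i] that by (cases "i = Suc j") auto
  show "i < j \<Longrightarrow> j \<le> n \<Longrightarrow> s i < s j" "i \<le> j \<Longrightarrow> j < n \<Longrightarrow> s i < r j"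
    "j < i \<Longrightarrow> i \<le> n \<Longrightarrow> r j < s i"
    by (fact s_less s_r r_s)+
qed

text \<open>Exactly the factors with \<open>s i > x\<close> are negative. This reads off the sign of
  a split polynomial by counting its zeros to the right of \<open>x\<close>.\<close>

lemma sign_prod_diff:
  fixes s :: "'a \<Rightarrow> real"
  assumes "finite I" "\<And>i. i \<in> I \<Longrightarrow> s i \<noteq> x"
  shows "(- 1) ^ card {i \<in> I. x < s i} * (\<Prod>i\<in>I. x - s i) > 0"
  using assms
proof (induction I rule: finite_induct)
  case (insert a I)
  then have IH: "(- 1) ^ card {i \<in> I. x < s i} * (\<Prod>i\<in>I. x - s i) > 0" by auto
  show ?case
  proof (cases "x < s a")
    case True
    then have "{i \<in> insert a I. x < s i} = insert a {i \<in> I. x < s i}" by auto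
    with insert.hyps IH True show ?thesis
      by (simp add: mult_less_0_iff zero_less_mult_iff)
  next
    case False
    then have "{i \<in> insert a I. x < s i} = {i \<in> I. x < s i}" by auto
    moreover have "x - s a > 0" using False insert.prems[of a] by simp
    ultimately show ?thesis using insert.hyps mult_pos_pos[OF _ IH, of "x - s a"]
      by (simp add: mult_ac)
  qed
qed auto

lemma degree_prod_linear: "degree (\<Prod>i<n. [:- r i, 1:]) = n" for r :: "nat \<Rightarrow> real"
  by (subst degree_prod_eq_sum_degree) auto

lemma lead_coeff_prod_linear: "lead_coeff (\<Prod>i<n. [:- r i, 1:]) = 1" for r :: "nat \<Rightarrow> real"
  by (simp add: lead_coeff_prod)

lemma split_over_degree: "split_over n r f \<Longrightarrow> degree f = n"
  unfolding split_over_def by (auto simp: degree_prod_linear)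

lemma split_over_poly:
  assumes "split_over n r f"
  obtains c where "c > 0" "\<And>x. poly f x = c * (\<Prod>i<n. x - r i)"
    "\<And>k. k < n \<Longrightarrow> poly (pderiv f) (r k) = c * (\<Prod>i\<in>{..<n} - {k}. r k - r i)"
proof -
  obtain c where c: "c > 0" "f = smult c (\<Prod>i<n. [:- r i, 1:])"
    using assms unfolding split_over_def by auto
  show thesis
  proof (rule that[OF c(1)])
    show "poly f x = c * (\<Prod>i<n. x - r i)" for x
      by (simp add: c(2) poly_prod)
  next
    fix k assume "k < n"
    \<comment> \<open>With \<open>f = c (x - r k) q\<close>, the product rule at \<open>r k\<close>
      leaves only \<open>c q(r k)\<close>.\<close>
    define q where "q = (\<Prod>i\<in>{..<n} - {k}. [:- r i, 1:])"
    have "f = smult c ([:- r k, 1:] * q)"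
      unfolding c(2) q_def using \<open>k < n\<close> by (subst prod.remove[of _ k]) auto
    then have "poly (pderiv f) (r k) = c * poly q (r k)"
      by (simp add: pderiv_smult pderiv_mult pderiv_pCons del: mult_pCons_left mult_pCons_right)
    then show "poly (pderiv f) (r k) = c * (\<Prod>i\<in>{..<n} - {k}. r k - r i)"
      by (simp add: q_def poly_prod)
  qed
qed

lemma split_over_root:
  assumes "split_over n r f"
  shows "poly f x = 0 \<longleftrightarrow> (\<exists>i<n. x = r i)"
proof -
  obtain c where "c > 0" "poly f x = c * (\<Prod>i<n. x - r i)"
    using split_over_poly[OF assms] by metis
  then show ?thesis by auto
qed

lemma sign_pos_infinity:
  fixes p :: "real poly"
  assumes "lead_coeff p > 0"
  obtains x where "x > c" "poly p x > 0"
proof -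
  obtain b where "\<forall>x\<ge>b. poly p x \<ge> lead_coeff p"
    using poly_pinfty_gt_lc[OF assms] by auto
  then show ?thesis using assms that[of "max b (c + 1)"]
    by (metis less_add_one less_le_trans max.cobounded1 max.cobounded2)
qed

lemma sign_neg_infinity:
  fixes p :: "real poly"
  assumes "lead_coeff p > 0"
  obtains x where "x < c" "(- 1) ^ degree p * poly p x > 0"
proof -
  \<comment> \<open>Reflection x -> -x reduces to the behaviour at plus infinity; the sign factor
    restores the leading coefficient.\<close>
  define q where "q = smult ((- 1) ^ degree p) (pcompose p [:0, - 1:])"
  have "lead_coeff q = lead_coeff p"
    by (simp add: q_def lead_coeff_comp flip: power_mult_distrib)
  with sign_pos_infinity[of q "- c"] assms obtain x where "x > - c" "poly q x > 0" by auto
  then show ?thesis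
    by (intro that[of "- x"]) (auto simp: q_def poly_pcompose)
qed

text \<open>Both sides have degree \<open>n\<close> and the same leading coefficient, so their
  difference has degree below \<open>n\<close> (or is 0); it vanishes at \<open>n\<close> distinct
  points.\<close>

lemma split_overI:
  assumes "lead_coeff f > 0" "degree f = n" "inj_on s {..<n}" "\<And>i. i < n \<Longrightarrow> poly f (s i) = 0"
  shows "split_over n s f"
proof -
  let ?g = "smult (lead_coeff f) (\<Prod>i<n. [:- s i, 1:])"
  have "poly ?g z = 0" if "z \<in> s ` {..<n}" for z
    using that by (auto simp: poly_prod)
  then have "f = ?g"
    using assms lead_coeff_prod_linear[of s n] degree_prod_linear[of s n]
    by (intro poly_eqI_degree_lead_coeff[of _ n _ "s ` {..<n}"]) (auto simp: card_image)
  then show ?thesis using assms(1) unfolding split_over_def by blast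
qed

text \<open>The signs at the \<open>n\<close> zeros of \<open>g\<close> alternate and continue the
  alternation between the far left and the far right. These \<open>n + 2\<close> points give
  \<open>n + 1\<close> zeros of \<open>f\<close>, as many as its degree allows.\<close>

lemma interleavedI_sign_changes:
  assumes g: "split_over n r g" and r: "\<And>i. Suc i < n \<Longrightarrow> r i < r (Suc i)"
    and f: "lead_coeff f > 0" "degree f = Suc n"
    and sign: "\<And>i. i < n \<Longrightarrow> (- 1) ^ (n - i) * poly f (r i) > 0"
  shows "interleaved n g f"
proof -
  obtain L where L: "L < r 0" "(- 1) ^ Suc n * poly f L > 0"
    using sign_neg_infinity[OF f(1), of "r 0"] f(2) by auto
  obtain U where U: "U > max L (r (n - 1))" "poly f U > 0"
    using sign_pos_infinity[OF f(1)] by blast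
  \<comment> \<open>The sample points in increasing order: \<open>L\<close>, then the zeros of
    \<open>g\<close> with index shifted by one, then \<open>U\<close>.\<close>
  define q where "q i = (if i = 0 then L else if i = Suc n then U else r (i - 1))" for i
  have q_less: "q i < q (Suc i)" if "i \<le> n" for i
    using that L U r[of "i - 1"] by (cases i) (auto simp: q_def)
  have q_sign: "(- 1) ^ (Suc n - i) * poly f (q i) > 0" if "i \<le> Suc n" for i
    using that L U sign[of "i - 1"] by (cases i) (auto simp: q_def)
  have "\<exists>x. q i < x \<and> x < q (Suc i) \<and> poly f x = 0" if "i \<le> n" for i
  proof -
    have e: "Suc n - i = Suc (n - i)" using that by simp
    have "(- 1) ^ Suc (n - i) * poly f (q i) > 0" "(- 1) ^ (n - i) * poly f (q (Suc i)) > 0"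
      using q_sign[of i] q_sign[of "Suc i"] that e by simp_all
    then have "poly f (q i) * poly f (q (Suc i)) < 0"
      by (cases "even (n - i)") (auto simp: mult_less_0_iff)
    then show ?thesis using poly_IVT[OF q_less[OF that]] by auto
  qed
  then obtain s where s: "\<And>i. i \<le> n \<Longrightarrow> q i < s i \<and> s i < q (Suc i) \<and> poly f (s i) = 0"
    by metis
  have s_r: "s i < r i \<and> r i < s (Suc i)" if "i < n" for i
    using s[of i] s[of "Suc i"] that by (auto simp: q_def)
  note s_less = alternating_less(1)[of n s r, OF s_r]
  have "inj_on s {..<Suc n}"
  proof (rule inj_onI)
    fix i j assume "i \<in> {..<Suc n}" "j \<in> {..<Suc n}" "s i = s j"
    then show "i = j"
      using s_less[of i j] s_less[of j i] by (cases i j rule: linorder_cases) auto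
  qed
  then have "split_over (Suc n) s f"
    using f s by (intro split_overI) auto
  then show ?thesis using g s_r unfolding interleaved_def by blast
qed

text \<open>The signs of \<open>F\<close> are tested only at zeros of \<open>f\<close>, where
  \<open>p * f\<close> vanishes; hence \<open>p\<close> is arbitrary. The case \<open>c = 0\<close>
  is allowed because it occurs in the first application.\<close>

lemma interleaved_step:
  assumes gf: "interleaved n g f" and F: "lead_coeff F > 0" "degree F = Suc (Suc n)"
    and neg: "\<And>x. poly f x = 0 \<Longrightarrow> x < 0"
    and rec: "smult A F = p * f + smult b (pCons 0 (pderiv f)) - smult c g"
    and "A > 0" "b > 0" "c \<ge> 0"
  shows "interleaved (Suc n) f F"
proof -
  obtain r s where g: "split_over n r g" and f: "split_over (Suc n) s f"
    and rs: "\<And>i. i < n \<Longrightarrow> s i < r i \<and> r i < s (Suc i)"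
    using gf unfolding interleaved_def by auto
  note s_less = alternating_less(1)[of n s r, OF rs]
    and s_r = alternating_less(2)[of n s r, OF rs]
    and r_s = alternating_less(3)[of n s r, OF rs]
  show ?thesis
  proof (rule interleavedI_sign_changes[OF f _ F])
    show "s i < s (Suc i)" if "Suc i < Suc n" for i using s_less that by simp
  next
    fix k assume k: "k < Suc n"
    obtain u where u: "u > 0" "\<And>x. poly g x = u * (\<Prod>i<n. x - r i)"
      using split_over_poly[OF g] by metis
    obtain v where v: "v > 0" "poly (pderiv f) (s k) = v * (\<Prod>i\<in>{..<Suc n} - {k}. s k - s i)"
      using split_over_poly[OF f] k by metis
    \<comment> \<open>The zeros of \<open>g\<close> to the right of \<open>s k\<close> are
      \<open>r k, ..., r (n - 1)\<close>, which are \<open>n - k\<close> in number.\<close>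
    have "s k < r i \<longleftrightarrow> k \<le> i" if "i < n" for i
      using s_r[of k i] r_s[of i k] k that by (cases "k \<le> i") auto
    then have "{i \<in> {..<n}. s k < r i} = {k..<n}" by auto
    moreover have "r i \<noteq> s k" if "i < n" for i
      using s_r[of k i] r_s[of i k] k that by (cases "k \<le> i") auto
    ultimately have "(- 1) ^ (n - k) * (\<Prod>i<n. s k - r i) > 0"
      using sign_prod_diff[of "{..<n}" r "s k"] by simp
    then have 1: "(- 1) ^ (n - k) * poly g (s k) > 0"
      using u by (simp add: zero_less_mult_iff mult_less_0_iff)
    \<comment> \<open>The zeros of \<open>f\<close> to the right of \<open>s k\<close> are
      \<open>s (k + 1), ..., s n\<close>, again \<open>n - k\<close> in number, so the derivative of
      \<open>f\<close> has the sign of \<open>g\<close> at \<open>s k\<close>.\<close>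
    have "s k < s i \<longleftrightarrow> k < i" if "i < Suc n" for i
      using s_less[of k i] s_less[of i k] k that by (cases i k rule: linorder_cases) auto
    then have "{i \<in> {..<Suc n} - {k}. s k < s i} = {Suc k..<Suc n}" by auto
    moreover have "s i \<noteq> s k" if "i \<in> {..<Suc n} - {k}" for i
      using s_less[of k i] s_less[of i k] k that by (cases i k rule: linorder_cases) auto
    ultimately have "(- 1) ^ (n - k) * (\<Prod>i\<in>{..<Suc n} - {k}. s k - s i) > 0"
      using sign_prod_diff[of "{..<Suc n} - {k}" s "s k"] by simp
    then have 2: "(- 1) ^ (n - k) * poly (pderiv f) (s k) > 0"
      using v by (simp add: zero_less_mult_iff mult_less_0_iff)
    have 0: "poly f (s k) = 0" using split_over_root[OF f] k by auto
    then have "s k < 0" by (rule neg)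
    then have "b * (- s k) * ((- 1) ^ (n - k) * poly (pderiv f) (s k)) > 0"
      using 2 \<open>b > 0\<close> by (metis mult_pos_pos neg_0_less_iff_less)
    moreover have "c * ((- 1) ^ (n - k) * poly g (s k)) \<ge> 0"
      using 1 \<open>c \<ge> 0\<close> by (metis mult_nonneg_nonneg less_imp_le)
    moreover have "A * ((- 1) ^ (Suc n - k) * poly F (s k)) = 
      b * (- s k) * ((- 1) ^ (n - k) * poly (pderiv f) (s k)) + c * ((- 1) ^ (n - k) * poly g (s k))"
    proof -
      have e: "Suc n - k = Suc (n - k)" using k by simp
      have "A * ((- 1) ^ (Suc n - k) * poly F (s k)) = - ((- 1) ^ (n - k)) * (A * poly F (s k))"
        unfolding e by simp
      also have "\<dots> = - ((- 1) ^ (n - k)) * (b * s k * poly (pderiv f) (s k) - c * poly g (s k))"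
        using arg_cong[OF rec, of "\<lambda>p. poly p (s k)"] 0 by (simp add: mult_ac)
      finally show ?thesis by (simp add: algebra_simps)
    qed
    ultimately have "A * ((- 1) ^ (Suc n - k) * poly F (s k)) > 0" by linarith
    then show "(- 1) ^ (Suc n - k) * poly F (s k) > 0"
      using \<open>A > 0\<close> by (simp add: zero_less_mult_iff)
  qed
qed

section \<open>From explicit real zeros to \<open>RZ\<close> and strict interlacing\<close>

lemma map_poly_of_real_mult:
  "map_poly complex_of_real (p * q) = map_poly complex_of_real p * map_poly complex_of_real q"
  by (rule poly_eqI) (simp add: coeff_map_poly coeff_mult)

lemma map_poly_of_real_prod:
  "map_poly complex_of_real (\<Prod>i\<in>I. f i) = (\<Prod>i\<in>I. map_poly complex_of_real (f i))"
  by (induction I rule: infinite_finite_induct) (simp_all add: map_poly_of_real_mult)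

lemma split_over_RZ:
  assumes "split_over n r f"
  shows "f \<in> RZ"
proof -
  obtain c where c: "c > 0" "f = smult c (\<Prod>i<n. [:- r i, 1:])"
    using assms unfolding split_over_def by auto
  have "z \<in> \<real>" if "poly (map_poly complex_of_real f) z = 0" for z
  proof -
    have "map_poly complex_of_real f = smult (of_real c) (\<Prod>i<n. map_poly of_real [:- r i, 1:])"
      unfolding c(2) by (simp add: map_poly_smult map_poly_of_real_prod)
    with that c(1) have "\<exists>i<n. z - of_real (r i) = 0"
      by (auto simp: poly_prod map_poly_pCons)
    then show ?thesis by auto
  qed
  then show ?thesis by (auto simp: RZ_def)
qed

lemma split_over_zeros_desc:
  assumes "split_over n r f" and "\<And>i. Suc i < n \<Longrightarrow> r i < r (Suc i)"
  shows "zeros_desc f = rev (map r [0..<n])"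
proof -
  have "proots f = proots (\<Prod>i<n. [:- r i, 1:])"
    using assms(1) unfolding split_over_def by auto
  also have "\<dots> = (\<Sum>i<n. {#r i#})"
    by (subst proots_prod) auto
  also have "\<dots> = mset (map r [0..<n])"
    by (induction n) auto
  finally have "proots f = mset (map r [0..<n])" .
  moreover have "sorted (map r [0..<n])"
    using assms(2) by (auto simp: sorted_iff_nth_Suc intro: less_imp_le)
  ultimately show ?thesis by (metis zeros_desc_def sorted_list_of_multiset_mset sorted_sort_id)
qed

lemma interleaved_imp_strictly_interlaces:
  assumes "interleaved n g f" shows "g \<prec> f"
proof -
  obtain r s where g: "split_over n r g" and f: "split_over (Suc n) s f"
    and rs: "\<And>i. i < n \<Longrightarrow> s i < r i \<and> r i < s (Suc i)"
    using assms unfolding interleaved_def by auto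
  note s_less = alternating_less(1)[of n s r, OF rs]
    and s_r = alternating_less(2)[of n s r, OF rs]
    and r_s = alternating_less(3)[of n s r, OF rs]
  have "zeros_desc f = rev (map s [0..<Suc n])"
    by (rule split_over_zeros_desc[OF f]) (use s_less in auto)
  moreover have "zeros_desc g = rev (map r [0..<n])"
  proof (rule split_over_zeros_desc[OF g])
    show "r i < r (Suc i)" if "Suc i < n" for i using rs[of i] rs[of "Suc i"] that by auto
  qed
  \<comment> \<open>Reversal sends index \<open>i\<close> to \<open>r (n - Suc i)\<close> for
    \<open>g\<close> and to \<open>s (n - i)\<close> for \<open>f\<close>, so this is the chain
    \<open>s j < r j < s (Suc j)\<close> at \<open>j = n - Suc i\<close>.\<close>
  ultimately have "zeros_desc f ! Suc i \<le> zeros_desc g ! i \<and> zeros_desc g ! i \<le> zeros_desc f ! i"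
    if "i < n" for i
    using rs[of "n - Suc i"] that
    by (auto simp: rev_nth nth_append Suc_diff_Suc simp del: upt_Suc)
  moreover have "poly f x \<noteq> 0 \<or> poly g x \<noteq> 0" for x
  proof -
    have "r i \<noteq> s k" if "i < n" "k < Suc n" for i k
      using s_r[of k i] r_s[of i k] that by (cases "k \<le> i") auto
    then show ?thesis by (auto simp: split_over_root[OF g] split_over_root[OF f])
  qed
  ultimately have "interlaces g f \<and> (\<nexists>x. poly f x = 0 \<and> poly g x = 0)"
    using split_over_degree[OF f] split_over_degree[OF g] split_over_RZ[OF f] split_over_RZ[OF g]
    by (auto simp: interlaces_def)
  then show ?thesis by (simp add: strictly_interlaces_def)
qed

section \<open>Recurrences for the polynomials\<close>

text \<open>The coefficient of \<open>(x + 1)\<^sup>j\<close> in \<open>P\<^sub>n\<close>, with junk values of truncated subtraction cut off.\<close>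

definition shift_coeff :: "nat \<Rightarrow> nat \<Rightarrow> real" where
  "shift_coeff n j = (if j \<le> n
     then 2 ^ j * real ((2 * n - 2 * j) choose (n - j)) * real ((n + j) choose j) / 2 ^ (2 * n)
     else 0)"

text \<open>Writing \<open>n = j + k\<close> removes truncated subtraction and turns ratios of
  neighbouring coefficients into field arithmetic.\<close>

lemma shift_coeff_eq_fact:
  "shift_coeff (j + k) j = 2 ^ j * fact (2 * k) * fact (2 * j + k) /
     (2 ^ (2 * (j + k)) * fact k ^ 2 * fact (j + k) * fact j)"
proof -
  have 1: "real ((2 * k) choose k) = fact (2 * k) / (fact k * fact k)"
    by (subst binomial_fact) (auto simp: mult_2)
  have 2: "real ((j + k + j) choose j) = fact (2 * j + k) / (fact j * fact (j + k))"
    using binomial_fact[of j "j + k + j", where 'a = real] by (simp add: mult_2 add_ac)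
  have 3: "2 * (j + k) - 2 * j = 2 * k" "j + k - j = k" by auto
  show ?thesis unfolding shift_coeff_def 3 1 2 by (simp add: power2_eq_square)
qed

text \<open>The hypergeometric ratio in \<open>j\<close>. For \<open>j = n\<close> both sides
  vanish, so no bound on \<open>j\<close> is required.\<close>

lemma shift_coeff_Suc_right:
  "(real j + 1) * (2 * real n - 2 * real j - 1) * shift_coeff n (Suc j)
   = (real n - real j) * (real n + real j + 1) * shift_coeff n j"
proof (cases "j < n")
  case True
  then obtain k where n: "n = j + Suc k" by (metis less_imp_Suc_add add_Suc_right)
  have a: "shift_coeff n (Suc j) = shift_coeff (Suc j + k) (Suc j)" using n by simp
  show ?thesis unfolding a unfolding n shift_coeff_eq_fact
    by (simp add: divide_simps power_add power2_eq_square) (simp add: algebra_simps)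
qed (auto simp: shift_coeff_def)

text \<open>The ratio along the diagonal, where \<open>n - j\<close> and with it the central
  binomial coefficient stay fixed.\<close>

lemma shift_coeff_Suc_Suc:
  "2 * (real n + 1) * (real j + 1) * shift_coeff (Suc n) (Suc j)
   = (real n + real j + 1) * (real n + real j + 2) * shift_coeff n j"
proof (cases "j \<le> n")
  case True
  then obtain k where n: "n = j + k" by (metis le_Suc_ex)
  have a: "shift_coeff (Suc n) (Suc j) = shift_coeff (Suc j + k) (Suc j)" using n by simp
  show ?thesis unfolding a unfolding n shift_coeff_eq_fact
    by (simp add: divide_simps power_add power2_eq_square) (simp add: algebra_simps)
qed (auto simp: shift_coeff_def)

lemma shift_coeff_Suc_0: "2 * (real n + 1) * shift_coeff (Suc n) 0 = (2 * real n + 1) * shift_coeff n 0"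
proof -
  have "2 * (real n + 1) * shift_coeff (0 + Suc n) 0 = (2 * real n + 1) * shift_coeff (0 + n) 0"
    unfolding shift_coeff_eq_fact
    by (simp add: divide_simps power_add power2_eq_square) (simp add: algebra_simps)
  then show ?thesis by simp
qed

lemma odd_nonzero: "2 * real n - 2 * real j - 1 \<noteq> 0"
proof
  assume "2 * real n - 2 * real j - 1 = 0"
  then have "real (2 * n) = real (2 * j + 1)" by simp
  then have "2 * n = 2 * j + 1" by (simp only: of_nat_eq_iff)
  then show False by presburger
qed

text \<open>After multiplication by \<open>j + 1\<close>, both ratios reduce every term to a
  multiple of \<open>shift_coeff n j\<close>; what remains is n + j + 2 = 2(j + 1) + (n -
  j).\<close>

lemma shift_coeff_Suc_n:
  "2 * (real n + 1) * shift_coeff (Suc n) (Suc j) =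
   2 * (real n + real j + 1) * shift_coeff n j + (2 * real n - 2 * real j - 1) * shift_coeff n (Suc j)"
proof -
  have "(real j + 1) * (2 * (real n + 1) * shift_coeff (Suc n) (Suc j)) =
    (real j + 1) * (2 * (real n + real j + 1) * shift_coeff n j
      + (2 * real n - 2 * real j - 1) * shift_coeff n (Suc j))"
    using shift_coeff_Suc_right[of j n] shift_coeff_Suc_Suc[of n j] by algebra
  then show ?thesis by simp
qed

text \<open>The coefficient of degree \<open>j + 1\<close> in the relation
  \<open>P_shift_pred\<close>.\<close>

lemma shift_coeff_pred_n:
  fixes n j :: nat
  defines "N \<equiv> real n + 1" and "x \<equiv> real j"
  shows
  "4 * N * (- x * shift_coeff (Suc n) j + 3 * (x + 1) * shift_coeff (Suc n) (Suc j)
      - 2 * (x + 2) * shift_coeff (Suc n) (Suc (Suc j)))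
    + 4 * N ^ 2 * shift_coeff (Suc n) j - (12 * N ^ 2 + 2 * N) * shift_coeff (Suc n) (Suc j)
    + (16 * N ^ 2 - 1) * shift_coeff n (Suc j) = 0" (is "?E = 0")
proof -
  define a b c d where "a = shift_coeff (Suc n) j" and "b = shift_coeff (Suc n) (Suc j)"
    and "c = shift_coeff (Suc n) (Suc (Suc j))" and "d = shift_coeff n (Suc j)"
  have 1: "(x + 1) * (2 * N - 2 * x - 1) * b = (N - x) * (N + x + 1) * a"
    using shift_coeff_Suc_right[of j "Suc n"] by (simp add: N_def x_def a_def b_def algebra_simps)
  have 2: "(x + 2) * (2 * N - 2 * x - 3) * c = (N - x - 1) * (N + x + 2) * b"
    using shift_coeff_Suc_right[of "Suc j" "Suc n"] by (simp add: N_def x_def c_def b_def algebra_simps)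
  have 3: "2 * N * (x + 2) * c = (N + x + 1) * (N + x + 2) * d"
    using shift_coeff_Suc_Suc[of n "Suc j"] by (simp add: N_def x_def c_def d_def algebra_simps)
  have n1: "2 * N - 2 * x - 1 \<noteq> 0" "2 * N - 2 * x - 3 \<noteq> 0"
    using odd_nonzero[of "Suc n" j] odd_nonzero[of n j] by (auto simp: N_def x_def algebra_simps)
  have n2: "N > 0" "x \<ge> 0" by (auto simp: N_def x_def)
  define X Y where "X = 2 * N - 2 * x - 1" and "Y = 2 * N - 2 * x - 3"
  \<comment> \<open>The ratios make \<open>b\<close>, \<open>c\<close> and \<open>d\<close> rational
    multiples of \<open>a\<close>, which leaves an identity in \<open>N\<close> and
    \<open>x\<close>. The factors \<open>X\<close> and \<open>Y\<close> are odd integers, hence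
    nonzero.\<close>
  have b: "b = (N - x) * (N + x + 1) * a / ((x + 1) * X)"
    using 1 n1 n2 by (subst nonzero_eq_divide_eq) (auto simp: X_def mult_ac)
  have c: "c = (N - x - 1) * (N + x + 2) * b / ((x + 2) * Y)"
    using 2 n1 n2 by (subst nonzero_eq_divide_eq) (auto simp: Y_def mult_ac)
  have d: "d = 2 * N * (x + 2) * c / ((N + x + 1) * (N + x + 2))"
    using 3 n1 n2 by (subst nonzero_eq_divide_eq) (auto simp: mult_ac)
  have "4 * N * (- x * a + 3 * (x + 1) * b - 2 * (x + 2) * c) + 4 * N^2 * a
    - (12 * N^2 + 2 * N) * b + (16 * N^2 - 1) * d = 0"
  proof -
    have d': "d = 2 * N * (N - x - 1) * (N - x) * a / ((x + 1) * X * Y)"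
      unfolding d c b using n1 n2 by (simp add: divide_simps X_def Y_def)
    have c': "c = (N - x - 1) * (N + x + 2) * (N - x) * (N + x + 1) * a / ((x + 2) * (x + 1) * X * Y)"
      unfolding c b using n1 n2 by (simp add: divide_simps X_def Y_def)
    have nn: "X \<noteq> 0" "Y \<noteq> 0" "x + 1 \<noteq> 0" "x + 2 \<noteq> 0" using n1 n2 by (auto simp: X_def Y_def)
    show ?thesis unfolding d' c' b using nn
      by (simp add: divide_simps) (simp add: X_def Y_def, algebra)
  qed
  then show ?thesis by (simp add: a_def b_def c_def d_def)
qed

lemma shift_coeff_pred_n_0:
  fixes n :: nat
  defines "N \<equiv> real n + 1"
  shows
  "- 8 * N * shift_coeff (Suc n) (Suc 0) - (12 * N ^ 2 + 2 * N) * shift_coeff (Suc n) 0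
    + (16 * N ^ 2 - 1) * shift_coeff n 0 = 0" (is "?E = 0")
proof -
  define b c d where "b = shift_coeff (Suc n) 0"
    and "c = shift_coeff (Suc n) (Suc 0)" and "d = shift_coeff n 0"
  have 1: "(2 * N - 1) * c = N * (N + 1) * b"
    using shift_coeff_Suc_right[of 0 "Suc n"] by (simp add: N_def c_def b_def algebra_simps)
  have 2: "2 * N * b = (2 * N - 1) * d"
    using shift_coeff_Suc_0[of n] by (simp add: N_def d_def b_def algebra_simps)
  have n1: "2 * N - 1 \<noteq> 0" by (auto simp: N_def)
  have "(2 * N - 1) * (- 8 * N * c - (12 * N^2 + 2 * N) * b + (16 * N^2 - 1) * d) = 0"
    using 1 2 by algebra
  then show ?thesis using n1 by (simp add: b_def c_def d_def)
qed

section \<open>The Boros-Moll polynomials in the variables t = x + 1 and x\<close>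

definition P_shift :: "nat \<Rightarrow> real poly" where
  "P_shift n = (\<Sum>j\<le>n. monom (shift_coeff n j) j)"

lemma coeff_P_shift [simp]: "coeff (P_shift n) j = shift_coeff n j"
  by (simp add: P_shift_def coeff_sum shift_coeff_def)

lemma P_poly_eq_pcompose: "P_poly n = pcompose (P_shift n) [:1, 1:]"
  by (rule poly_ext)
     (simp add: P_poly_def P_shift_def poly_pcompose poly_sum poly_monom poly_power sum_distrib_left
       shift_coeff_def atMost_atLeast0 mult_ac cong: sum.cong_simp)

lemma poly_P_poly: "poly (P_poly n) x = poly (P_shift n) (1 + x)"
  by (simp add: P_poly_eq_pcompose poly_pcompose)

lemma poly_pderiv_P_poly: "poly (pderiv (P_poly n)) x = poly (pderiv (P_shift n)) (1 + x)"
  by (simp add: P_poly_eq_pcompose pderiv_pcompose pderiv_pCons poly_pcompose)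

lemma P_shift_Suc:
  "smult (2 * (real n + 1)) (P_shift (Suc n)) =
     [:2 * real n + 1, 2 * real n + 2:] * P_shift n + [:0, - 2, 2:] * pderiv (P_shift n)" (is "?l = ?r")
proof (rule poly_eqI)
  fix i
  show "coeff ?l i = coeff ?r i"
  proof (cases i)
    case 0
    then show ?thesis using shift_coeff_Suc_0[of n] by (simp add: algebra_simps)
  next
    case (Suc j)
    then show ?thesis using shift_coeff_Suc_n[of n j]
      by (cases j) (simp_all add: coeff_pCons coeff_pderiv algebra_simps)
  qed
qed

lemma P_shift_pred:
  fixes n :: nat
  defines "N \<equiv> real n + 1"
  shows "[:- 12 * N ^ 2 - 2 * N, 4 * N ^ 2:] * P_shift (Suc n)
     + smult (4 * N) ([:- 2, 3, - 1:] * pderiv (P_shift (Suc n))) + smult (16 * N ^ 2 - 1) (P_shift n) = 0"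
    (is "?l = 0")
proof (rule poly_eqI)
  fix i
  show "coeff ?l i = coeff 0 i"
  proof (cases i)
    case 0
    then show ?thesis using shift_coeff_pred_n_0[of n] by (simp add: coeff_pderiv N_def algebra_simps)
  next
    case (Suc j)
    then show ?thesis using shift_coeff_pred_n[of n j] 
      by (cases j) (simp_all add: coeff_pCons coeff_pderiv N_def algebra_simps)
  qed
qed

text \<open>Under t = x + 1 the factor 2t(t - 1) of the derivative becomes 2x(x + 1), and in
  \<open>P_poly_pred\<close> -(t - 1)(t - 2) becomes x(1 - x). Both vanish at x = 0, so the
  coefficient relations link only the indices \<open>i\<close> and \<open>i + 1\<close>.\<close>

lemma P_poly_Suc:
  "smult (2 * (real n + 1)) (P_poly (Suc n)) =
     [:4 * real n + 3, 2 * real n + 2:] * P_poly n + [:0, 2, 2:] * pderiv (P_poly n)"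
proof (rule poly_ext)
  fix x
  show "poly (smult (2 * (real n + 1)) (P_poly (Suc n))) x =
     poly ([:4 * real n + 3, 2 * real n + 2:] * P_poly n + [:0, 2, 2:] * pderiv (P_poly n)) x"
    using arg_cong[OF P_shift_Suc[of n], of "\<lambda>p. poly p (1 + x)"]
    by (simp add: poly_P_poly poly_pderiv_P_poly algebra_simps)
qed

lemma P_poly_pred:
  fixes n :: nat
  defines "N \<equiv> real n + 1"
  shows "[:- 8 * N ^ 2 - 2 * N, 4 * N ^ 2:] * P_poly (Suc n)
     + smult (4 * N) ([:0, 1, - 1:] * pderiv (P_poly (Suc n))) + smult (16 * N ^ 2 - 1) (P_poly n) = 0"
    (is "?l = 0")
proof (rule poly_ext)
  fix x
  show "poly ?l x = poly 0 x"
    using arg_cong[OF P_shift_pred[of n], of "\<lambda>p. poly p (1 + x)"]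
    by (simp add: poly_P_poly poly_pderiv_P_poly N_def algebra_simps)
qed

lemma d_coeff_Suc_n:
  "2 * (real n + 1) * d_coeff (Suc i) (Suc n) =
     2 * (real n + real i + 1) * d_coeff i n + (4 * real n + 2 * real i + 5) * d_coeff (Suc i) n"
  using arg_cong[OF P_poly_Suc[of n], of "\<lambda>p. coeff p (Suc i)"]
  by (cases i) (simp_all add: d_coeff_def coeff_pCons coeff_pderiv algebra_simps)

lemma d_coeff_Suc_n_0:
  "2 * (real n + 1) * d_coeff 0 (Suc n) = (4 * real n + 3) * d_coeff 0 n"
  using arg_cong[OF P_poly_Suc[of n], of "\<lambda>p. coeff p 0"]
  by (simp add: d_coeff_def coeff_pCons coeff_pderiv algebra_simps)

lemma d_coeff_pred_n:
  fixes n i :: nat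
  defines "N \<equiv> real n + 1"
  shows "(16 * N ^ 2 - 1) * d_coeff (Suc i) n =
    2 * N * (4 * N - 1 - 2 * real i) * d_coeff (Suc i) (Suc n) - 4 * N * (N - real i) * d_coeff i (Suc n)"
  using arg_cong[OF P_poly_pred[of n], of "\<lambda>p. coeff p (Suc i)"]
  by (cases i) (simp_all add: d_coeff_def coeff_pCons coeff_pderiv N_def power2_eq_square algebra_simps)

lemma d_coeff_pred_n_0:
  fixes n :: nat
  defines "N \<equiv> real n + 1"
  shows "(16 * N ^ 2 - 1) * d_coeff 0 n = 2 * N * (4 * N + 1) * d_coeff 0 (Suc n)"
  using arg_cong[OF P_poly_pred[of n], of "\<lambda>p. coeff p 0"]
  by (simp add: d_coeff_def coeff_pCons coeff_pderiv N_def power2_eq_square algebra_simps)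

lemma d_coeff_eq_0: "n < i \<Longrightarrow> d_coeff i n = 0"
proof -
  assume "n < i"
  have "degree (P_shift n) \<le> n"
    by (rule degree_le) (simp add: shift_coeff_def)
  then have "degree (P_poly n) \<le> n"
    by (simp add: P_poly_eq_pcompose degree_pcompose)
  then show ?thesis
    using \<open>n < i\<close> by (simp add: d_coeff_def coeff_eq_0)
qed

lemma d_coeff_0_0: "d_coeff 0 0 = 1"
  by (simp add: d_coeff_def P_poly_def)

lemma d_coeff_pos: "i \<le> n \<Longrightarrow> d_coeff i n > 0"
proof (induction n arbitrary: i)
  case 0
  then show ?case by (simp add: d_coeff_0_0)
next
  case (Suc n)
  have "2 * (real n + 1) * d_coeff i (Suc n) > 0"
  proof (cases i)
    case 0
    then show ?thesis using Suc.IH[of 0] by (simp only: d_coeff_Suc_n_0) simp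
  next
    case (Suc j)
    \<comment> \<open>For \<open>j = n\<close> the second coefficient lies beyond the degree and is
      0; otherwise it is positive by induction.\<close>
    have "d_coeff j n > 0" "d_coeff (Suc j) n \<ge> 0"
      using Suc Suc.IH[of j] Suc.IH[of "Suc j"] Suc.prems d_coeff_eq_0[of n "Suc j"]
      by (auto simp: not_le) (metis less_le_not_le not_le order_refl)
    then have "2 * (real n + real j + 1) * d_coeff j n > 0"
      "(4 * real n + 2 * real j + 5) * d_coeff (Suc j) n \<ge> 0" by simp_all
    then show ?thesis unfolding \<open>i = Suc j\<close> d_coeff_Suc_n by linarith
  qed
  then show ?case by (simp add: zero_less_mult_iff)
qed

section \<open>The weighted polynomials R_n\<close>

lemma coeff_R_poly: "coeff (R_poly n) i = d_coeff i n / fact (i + 2)"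
  by (cases "i \<le> n") (simp_all add: R_poly_def coeff_sum d_coeff_eq_0)

lemma degree_R_poly: "degree (R_poly n) = n"
proof (rule antisym)
  show "degree (R_poly n) \<le> n" by (rule degree_le) (simp add: coeff_R_poly d_coeff_eq_0)
  show "n \<le> degree (R_poly n)"
    using d_coeff_pos[of n n] by (intro le_degree) (simp add: coeff_R_poly)
qed

lemma lead_coeff_R_poly_pos: "lead_coeff (R_poly n) > 0"
  using d_coeff_pos[of n n] by (simp add: degree_R_poly coeff_R_poly)

text \<open>The weights at \<open>i\<close> and \<open>i + 1\<close> differ by the factor
  \<open>i + 3\<close>. The two coefficient relations are combined so that \<open>d_coeff i\<close>
  receives a multiple of \<open>i + 3\<close>, which turns its term into x times
  \<open>R_poly (Suc n)\<close>.\<close>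

lemma R_poly_recurrence:
  fixes n :: nat
  defines "N \<equiv> real n + 1"
  shows "smult (4 * N * (N + 1) * (N + 3)) (R_poly (Suc (Suc n))) =
    [:2 * N * (8 * N ^ 2 + 8 * N + 7), 4 * N * (2 * N + 1):] * R_poly (Suc n)
    + smult (20 * N) (pCons 0 (pderiv (R_poly (Suc n)))) - smult ((16 * N ^ 2 - 1) * (N - 2)) (R_poly n)"
    (is "?l = ?r")
proof (rule poly_eqI)
  fix k
  show "coeff ?l k = coeff ?r k"
  proof (cases k)
    case 0
    define b c e where "b = d_coeff 0 (Suc n)" and "c = d_coeff 0 (Suc (Suc n))" and "e = d_coeff 0 n"
    have A: "2 * (N + 1) * c = (4 * N + 3) * b"
      using d_coeff_Suc_n_0[of "Suc n"] by (simp add: b_def c_def N_def algebra_simps)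
    have B: "(16 * N ^ 2 - 1) * e = 2 * N * (4 * N + 1) * b"
      using d_coeff_pred_n_0[of n] by (simp add: b_def e_def N_def)
    \<comment> \<open>The combination of the general case below, formally at \<open>I = - 1\<close>
      with \<open>a = 0\<close>.\<close>
    have "4 * N * (N + 1) * (N + 3) * c =
      2 * N * (8 * N ^ 2 + 8 * N + 7) * b - (16 * N ^ 2 - 1) * (N - 2) * e"
      using A B by algebra
    then show ?thesis
      by (simp add: 0 coeff_R_poly b_def c_def e_def fact_numeral)
  next
    case (Suc i)
    define I where "I = real i"
    define a b c e where "a = d_coeff i (Suc n)" and "b = d_coeff (Suc i) (Suc n)"
      and "c = d_coeff (Suc i) (Suc (Suc n))" and "e = d_coeff (Suc i) n"
    have A: "2 * (N + 1) * c = 2 * (N + I + 1) * a + (4 * N + 2 * I + 5) * b"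
      using d_coeff_Suc_n[of "Suc n" i] by (simp add: a_def b_def c_def N_def I_def algebra_simps)
    have B: "(16 * N ^ 2 - 1) * e = 2 * N * (4 * N - 1 - 2 * I) * b - 4 * N * (N - I) * a"
      using d_coeff_pred_n[of n i] by (simp add: a_def b_def e_def N_def I_def)
    \<comment> \<open>This is 2N(N + 3) times \<open>A\<close> plus (N - 2) times \<open>B\<close>.
      The factor of \<open>b\<close> is affine in \<open>I\<close>; its part 20N(I + 1) yields the
      derivative term.\<close>
    have main: "4 * N * (N + 1) * (N + 3) * c =
      2 * N * (8 * N ^ 2 + 8 * N + 7) * b + 4 * N * (2 * N + 1) * (I + 3) * a
      + 20 * N * (I + 1) * b - (16 * N ^ 2 - 1) * (N - 2) * e"
      using A B by algebra
    define F :: real where "F = fact (i + 2)"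
    have pos: "F \<noteq> 0" "I + 3 \<noteq> 0" by (simp_all add: F_def I_def)
    have "fact (Suc i + 2) = (I + 3) * F" by (simp add: F_def I_def algebra_simps)
    then have l: "coeff ?l k = 4 * N * (N + 1) * (N + 3) * c / ((I + 3) * F)"
      and "coeff ?r k = 2 * N * (8 * N ^ 2 + 8 * N + 7) * (b / ((I + 3) * F))
      + 4 * N * (2 * N + 1) * (a / F) + 20 * N * ((I + 1) * (b / ((I + 3) * F)))
      - (16 * N ^ 2 - 1) * (N - 2) * (e / ((I + 3) * F))"
      by (simp_all add: Suc coeff_R_poly coeff_pderiv a_def b_def c_def e_def F_def I_def
          add.commute del: fact_Suc)
    note this(2)
    also have "\<dots> = (2 * N * (8 * N ^ 2 + 8 * N + 7) * b + 4 * N * (2 * N + 1) * (I + 3) * a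
      + 20 * N * (I + 1) * b - (16 * N ^ 2 - 1) * (N - 2) * e) / ((I + 3) * F)"
      using pos by (simp add: add_divide_distrib diff_divide_distrib)
    finally show ?thesis by (simp only: l main)
  qed
qed

lemma R_poly_1: "R_poly (Suc 0) = smult (1 / 6) [:9 / 2, 1:]"
  by (simp add: R_poly_def d_coeff_def P_poly_def monom_altdef fact_numeral)

lemma R_poly_2: "R_poly (Suc (Suc 0)) = smult (1 / 16) ([:7, 1:] * [:3, 1:])"
proof -
  have "R_poly (Suc 0) = [:3 / 4, 1 / 6:]" by (simp add: R_poly_1)
  \<comment> \<open>Undoing the weights 1/2! and 1/3! gives the coefficients of P_1, from which
    those of P_2 follow by the recurrence.\<close>
  then have "d_coeff 0 (Suc 0) = 3 / 2" "d_coeff (Suc 0) (Suc 0) = 1"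
    using coeff_R_poly[of "Suc 0" 0] coeff_R_poly[of "Suc 0" "Suc 0"] by (simp_all add: fact_numeral)
  then show ?thesis
    using d_coeff_Suc_n_0[of "Suc 0"] d_coeff_Suc_n[of "Suc 0" 0] d_coeff_Suc_n[of "Suc 0" "Suc 0"]
      d_coeff_eq_0[of "Suc 0" 2]
    by (simp add: R_poly_def monom_altdef fact_numeral numeral_2_eq_2)
qed

section \<open>The Sturm property\<close>

lemma poly_R_poly_pos:
  assumes "x \<ge> 0"
  shows "poly (R_poly n) x > 0"
  unfolding poly_altdef degree_R_poly coeff_R_poly
\<comment> \<open>The constant term is positive even at \<open>x = 0\<close>, which excludes 0 as a
  zero.\<close>
proof (rule sum_pos2[of _ 0])
  show "0 < d_coeff 0 n / fact (0 + 2) * x ^ 0" using d_coeff_pos[of 0 n] by simp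
  show "0 \<le> d_coeff i n / fact (i + 2) * x ^ i" if "i \<in> {..n}" for i
    using that assms d_coeff_pos[of i n] by (intro mult_nonneg_nonneg divide_nonneg_pos) auto
qed auto

lemma interleaved_R_poly: "interleaved (Suc n) (R_poly (Suc n)) (R_poly (Suc (Suc n)))"
proof (induction n)
  case 0
  \<comment> \<open>The base case is -7 < -9/2 < -3.\<close>
  have "split_over (Suc 0) (\<lambda>_. - 9 / 2) (R_poly (Suc 0))"
    unfolding split_over_def by (intro exI[of _ "1 / 6"]) (simp add: R_poly_1)
  moreover have "split_over (Suc (Suc 0)) (\<lambda>i. if i = 0 then - 7 else - 3) (R_poly (Suc (Suc 0)))"
    unfolding split_over_def by (intro exI[of _ "1 / 16"]) (simp add: R_poly_2)
  ultimately show ?case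
    unfolding interleaved_def
    by (intro exI[of _ "\<lambda>_. - 9 / 2"] exI[of _ "\<lambda>i. if i = 0 then - 7 else - 3"])
       simp
next
  case (Suc n)
  \<comment> \<open>\<open>N\<close> is the degree of the middle polynomial, hence at least 2, and
    \<open>N - 2\<close> is 0 in the first step.\<close>
  define N where "N = real (Suc n) + 1"
  show ?case
  proof (rule interleaved_step[OF Suc])
    show "lead_coeff (R_poly (Suc (Suc (Suc n)))) > 0"
      by (rule lead_coeff_R_poly_pos)
    show "degree (R_poly (Suc (Suc (Suc n)))) = Suc (Suc (Suc n))"
      by (rule degree_R_poly)
    show "x < 0" if "poly (R_poly (Suc (Suc n))) x = 0" for x
      using poly_R_poly_pos[of x "Suc (Suc n)"] that by (cases "x < 0") auto
    show "smult (4 * N * (N + 1) * (N + 3)) (R_poly (Suc (Suc (Suc n)))) =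
      [:2 * N * (8 * N ^ 2 + 8 * N + 7), 4 * N * (2 * N + 1):] * R_poly (Suc (Suc n))
      + smult (20 * N) (pCons 0 (pderiv (R_poly (Suc (Suc n)))))
      - smult ((16 * N ^ 2 - 1) * (N - 2)) (R_poly (Suc n))"
      unfolding N_def by (rule R_poly_recurrence)
    have "N \<ge> 2" by (simp add: N_def)
    moreover have "16 * N ^ 2 - 1 \<ge> 0"
      using \<open>N \<ge> 2\<close> one_le_power[of N 2] by linarith
    ultimately show "4 * N * (N + 1) * (N + 3) > 0" "20 * N > 0" "(16 * N ^ 2 - 1) * (N - 2) \<ge> 0"
      by simp_all
  qed
qed

theorem theorem2p5:
  shows "Sturm_sequence R_poly \<and> (\<forall>n\<ge>1. R_poly n \<in> RZ)"
proof -
  have RZ: "R_poly n \<in> RZ" for n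
  proof (cases n)
    case 0
    then show ?thesis by (simp add: RZ_def degree_R_poly)
  next
    case (Suc m)
    then show ?thesis
      using interleaved_R_poly[of m] split_over_RZ unfolding interleaved_def by blast
  qed
  have "R_poly n \<prec> R_poly (Suc n)" for n
  proof (cases n)
    case 0
    \<comment> \<open>The induction on interleaving starts at R_1; here the convention for a
      constant and a linear polynomial applies.\<close>
    have "R_poly 0 = [:coeff (R_poly 0) 0:]"
      by (rule degree_eq_zeroE[of "R_poly 0"]) (simp_all add: degree_R_poly)
    moreover have "R_poly (Suc 0) = [:3 / 4, 1 / 6:]" by (simp add: R_poly_1)
    ultimately show ?thesis unfolding 0 strictly_interlaces_def by blast
  next
    case (Suc m)
    then show ?thesis
      using interleaved_R_poly[of m] interleaved_imp_strictly_interlaces by blast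
  qed
  then have "Sturm_sequence R_poly"
    using RZ lead_coeff_R_poly_pos by (auto simp: Sturm_sequence_def standard_poly_def degree_R_poly)
  with RZ show ?thesis by blast
qed

end
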